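(* Let $D_S$ be an $r$-regular digraph with self-loops of order $n$ with $\sigma$ self-loops and adjacency matrix $A(D_S)$. If $r,\lambda_2,\dots,\lambda_n$ are the eigenvalues of $A(D_S)$, then $n-r-\delta_\sigma,\,-\delta_\sigma-\lambda_2,\dots,-\delta_\sigma-\lambda_n$ are the eigenvalues of $A(\overline{D_S})$.
   Context: A digraph with self-loops $D_S$ is a pair $(V,\mathcal A)$ with $V$ a nonempty finite vertex set and $\mathcal A\subseteq V\times V$ a set of arcs; $S=\{v\in V:(v,v)\in\mathcal A\}$ is the self-loop set (possibly empty). The order is $n=|V|$ and $\sigma=|S|$. The adjacency matrix $A(D_S)=(a_{ij})$ has $a_{ij}=1$ if $(v_i,v_j)\in\mathcal A$ and $0$ otherwise; eigenvalues are counted with algebraic multiplicity. The out-degree of $v_i$ is $\sum_ja_{ij}$ and the in-degree is $\sum_ja_{ji}$ (each self-loop contributes $1$ to both). $D_S$ is $r$-regular if every vertex has in-degree and out-degree equal to $r$. Put $\delta_\sigma=1$ if $\sigma=0$ and $\delta_\sigma=0$ if $\sigma\ne0$. The complement $\overline{D_S}$ is the digraph with self-loops on $V$ with adjacency matrix $A(\overline{D_S})=J_n-\delta_\sigma I_n-A(D_S)$, where $J_n$ is the all-ones matrix and $I_n$ the identity matrix. *)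

theory Defs
  imports
    "Graph_Theory.Pair_Digraph"
    "Jordan_Normal_Form.Char_Poly"
    "HOL-Computational_Algebra.Fundamental_Theorem_Algebra"
begin

text \<open>
  A pair digraph has a vertex set and a set of ordered pairs as arcs; loops are allowed.
  The locale \<^locale>\<open>pair_fin_digraph\<close> admits the empty vertex set, which is excluded here.
\<close>

locale self_loop_digraph = pair_fin_digraph D for D :: "'a pair_pre_digraph" +
  assumes verts_nonempty: "pverts D \<noteq> {}"

definition self_loops :: "'a pair_pre_digraph \<Rightarrow> 'a set" where
  "self_loops D = {v \<in> pverts D. (v, v) \<in> parcs D}"

definition loop_delta :: "nat \<Rightarrow> nat" where
  "loop_delta \<sigma> = (if \<sigma> = 0 then 1 else 0)"

definition regular_digraph :: "nat \<Rightarrow> 'a pair_pre_digraph \<Rightarrow> bool" where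
  "regular_digraph r D \<longleftrightarrow> (\<forall>v\<in>pverts D. in_degree D v = r \<and> out_degree D v = r)"

definition adj_entry :: "'a pair_pre_digraph \<Rightarrow> 'a \<Rightarrow> 'a \<Rightarrow> complex" where
  "adj_entry D u v = (if (u, v) \<in> parcs D then 1 else 0)"

text \<open>
  The list \<^term>\<open>vs\<close> is meant to enumerate the vertices without repetition. The matrix has
  complex entries so that all of its eigenvalues are available.
\<close>

definition adj_matrix :: "'a list \<Rightarrow> 'a pair_pre_digraph \<Rightarrow> complex mat" where
  "adj_matrix vs D = mat (length vs) (length vs) (\<lambda>(i, j). adj_entry D (vs ! i) (vs ! j))"

definition all_ones_mat :: "nat \<Rightarrow> complex mat" where
  "all_ones_mat n = mat n n (\<lambda>_. 1)"

text \<open>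
  The complement is given by its adjacency matrix $J - \delta I - A$: an arc is present exactly
  when that entry is 1. That this realises the matrix, and is the only digraph on the same
  vertices that does, is shown in \<open>adj_matrix_complement\<close> and \<open>complement_unique\<close>.
\<close>

definition complement_digraph :: "'a pair_pre_digraph \<Rightarrow> 'a pair_pre_digraph" where
  "complement_digraph D =
     \<lparr> pverts = pverts D,
       parcs = {(u, v) \<in> pverts D \<times> pverts D.
         1 - of_nat (loop_delta (card (self_loops D))) * (if u = v then 1 else 0)
           - adj_entry D u v = 1} \<rparr>"

definition eigenvalues :: "complex mat \<Rightarrow> complex multiset" where
  "eigenvalues A = proots (char_poly A)"

lemma out_degree_eq_row_sum:
  assumes "self_loop_digraph D" "u \<in> pverts D"
  shows "of_nat (out_degree D u) = (\<Sum>v\<in>pverts D. adj_entry D u v)"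
proof -
  interpret self_loop_digraph D by fact
  have "out_arcs D u = Pair u ` {v \<in> pverts D. (u, v) \<in> parcs D}"
    by (auto simp: out_arcs_def dest: in_arcsD2)
  then have "out_degree D u = card {v \<in> pverts D. (u, v) \<in> parcs D}"
    by (simp add: out_degree_def card_image inj_on_def)
  then show ?thesis
    using pair_finite_verts by (simp add: adj_entry_def sum.If_cases Collect_conj_eq)
qed

lemma in_degree_eq_column_sum:
  assumes "self_loop_digraph D" "v \<in> pverts D"
  shows "of_nat (in_degree D v) = (\<Sum>u\<in>pverts D. adj_entry D u v)"
proof -
  interpret self_loop_digraph D by fact
  have "in_arcs D v = (\<lambda>u. (u, v)) ` {u \<in> pverts D. (u, v) \<in> parcs D}"
    by (auto simp: in_arcs_def dest: in_arcsD1)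
  then have "in_degree D v = card {u \<in> pverts D. (u, v) \<in> parcs D}"
    by (simp add: in_degree_def card_image inj_on_def)
  then show ?thesis
    using pair_finite_verts by (simp add: adj_entry_def sum.If_cases Collect_conj_eq)
qed

lemma self_loop_digraph_complement:
  assumes "self_loop_digraph D"
  shows "self_loop_digraph (complement_digraph D)"
proof -
  interpret self_loop_digraph D by fact
  have "parcs (complement_digraph D) \<subseteq> pverts D \<times> pverts D"
    by (auto simp: complement_digraph_def)
  moreover from this have "finite (parcs (complement_digraph D))"
    by (rule finite_subset) (simp add: pair_finite_verts)
  ultimately show ?thesis
    using pair_finite_verts verts_nonempty
    by unfold_locales (auto simp: complement_digraph_def)
qed

lemma adj_entry_complement:
  assumes "self_loop_digraph D" "u \<in> pverts D" "v \<in> pverts D"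
  shows "adj_entry (complement_digraph D) u v =
    1 - of_nat (loop_delta (card (self_loops D))) * (if u = v then 1 else 0) - adj_entry D u v"
proof -
  interpret self_loop_digraph D by fact
  have "finite (self_loops D)"
    using pair_finite_verts by (simp add: self_loops_def)
  then show ?thesis
    using assms(2,3)
    by (auto simp: adj_entry_def complement_digraph_def loop_delta_def self_loops_def)
qed

lemma adj_matrix_complement:
  assumes "self_loop_digraph D" "distinct vs" "set vs = pverts D"
  shows "adj_matrix vs (complement_digraph D) =
    all_ones_mat (length vs)
      - of_nat (loop_delta (card (self_loops D))) \<cdot>\<^sub>m 1\<^sub>m (length vs)
      - adj_matrix vs D"
proof (rule eq_matI, goal_cases)
  case (1 i j)
  then have ij: "i < length vs" "j < length vs"
    by (simp_all add: adj_matrix_def)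
  then have "vs ! i \<in> pverts D" "vs ! j \<in> pverts D"
    using assms(3) nth_mem by blast+
  with ij show ?case
    using adj_entry_complement[OF assms(1)] assms(2)
    by (simp add: adj_matrix_def all_ones_mat_def nth_eq_iff_index_eq)
qed (simp_all add: adj_matrix_def all_ones_mat_def)

lemma complement_unique:
  assumes D: "self_loop_digraph D" and vs: "distinct vs" "set vs = pverts D"
    and E: "self_loop_digraph E" "pverts E = pverts D"
    and eq: "adj_matrix vs E =
      all_ones_mat (length vs)
        - of_nat (loop_delta (card (self_loops D))) \<cdot>\<^sub>m 1\<^sub>m (length vs)
        - adj_matrix vs D"
  shows "E = complement_digraph D"
proof -
  interpret E: self_loop_digraph E by fact
  interpret C: self_loop_digraph "complement_digraph D"
    by (rule self_loop_digraph_complement[OF D])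
  have V: "pverts (complement_digraph D) = pverts D"
    by (simp add: complement_digraph_def)
  have M: "adj_matrix vs E = adj_matrix vs (complement_digraph D)"
    using eq adj_matrix_complement[OF D vs] by simp
  have iff: "(u, v) \<in> parcs E \<longleftrightarrow> (u, v) \<in> parcs (complement_digraph D)"
    if uv: "u \<in> pverts D" "v \<in> pverts D" for u v
  proof -
    obtain i j where ij: "i < length vs" "j < length vs" "vs ! i = u" "vs ! j = v"
      using uv vs(2) by (metis in_set_conv_nth)
    have "adj_matrix vs E $$ (i, j) = adj_matrix vs (complement_digraph D) $$ (i, j)"
      using M by simp
    with ij have "adj_entry E u v = adj_entry (complement_digraph D) u v"
      by (simp add: adj_matrix_def)
    then show ?thesis
      by (simp add: adj_entry_def split: if_splits)
  qed
  have "parcs E = parcs (complement_digraph D)"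
  proof (rule Set.set_eqI)
    fix e
    show "e \<in> parcs E \<longleftrightarrow> e \<in> parcs (complement_digraph D)"
      using iff E(2) V E.in_arcsD1 E.in_arcsD2 C.in_arcsD1 C.in_arcsD2
      by (cases e) metis
  qed
  with E(2) V show ?thesis
    by (intro pair_pre_digraph.equality) auto
qed

end

theory Submission
  imports Defs "Jordan_Normal_Form.Schur_Decomposition"
begin

text \<open>
  If all rows of an $(m+1) \times (m+1)$ matrix $M$ sum to $s$, the all-ones vector is an
  eigenvector, and replacing the first basis vector by it makes $M$ block triangular with
  diagonal blocks $s$ and $B_M = (M_{i+1,j+1} - M_{0,j+1})_{i,j<m}$. The map $M \mapsto B_M$ is
  linear with $B_J = 0$ and $B_I = I$, so passing from $A$ to $J - \delta I - A$ replaces $r$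
  by $n - \delta - r$ and $B_A$ by $-\delta I - B_A$. The spectrum of the latter is read off a
  Schur form of $B_A$.
\<close>

lemma proots_prod_list_linear:
  fixes as :: "'a :: idom list"
  shows "proots (\<Prod>a\<leftarrow>as. [:- a, 1:]) = mset as"
proof (induction as)
  case (Cons a as)
  have "(\<Prod>a\<leftarrow>as. [:- a, 1:]) \<noteq> 0"
    by (auto simp: prod_list_zero_iff)
  then show ?case
    using Cons.IH by (simp add: proots_mult del: mult_pCons_left)
qed simp

lemma eigenvalues_upper_triangular:
  assumes "T \<in> carrier_mat n n" "upper_triangular T"
  shows "eigenvalues T = mset (diag_mat T)"
  using char_poly_upper_triangular[OF assms]
  by (simp add: eigenvalues_def proots_prod_list_linear)

lemma eigenvalues_similar: "similar_mat A B \<Longrightarrow> eigenvalues A = eigenvalues B"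
  by (simp add: eigenvalues_def char_poly_similar)

text \<open>Scalar matrices commute with everything, so the pair \<open>P\<close>, \<open>Q\<close>
  that conjugates \<open>B\<close> to \<open>A\<close> fixes
  \<open>c \<cdot>\<^sub>m 1\<^sub>m n\<close> and serves again.\<close>

lemma similar_mat_scalar_minus:
  fixes A B :: "'a :: comm_ring_1 mat"
  assumes A: "A \<in> carrier_mat n n" and sim: "similar_mat A B"
  shows "similar_mat (c \<cdot>\<^sub>m 1\<^sub>m n - A) (c \<cdot>\<^sub>m 1\<^sub>m n - B)"
proof -
  obtain P Q where "similar_mat_wit A B P Q"
    using sim by (auto simp: similar_mat_def)
  note w = similar_mat_witD2[OF A this]
  have "P * (c \<cdot>\<^sub>m 1\<^sub>m n - B) = c \<cdot>\<^sub>m P - P * B"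
    using w by (subst mult_minus_distrib_mat[of _ n n]) auto
  then have "P * (c \<cdot>\<^sub>m 1\<^sub>m n - B) * Q = c \<cdot>\<^sub>m (P * Q) - P * B * Q"
    using w by (simp add: minus_mult_distrib_mat[of _ n n] mult_smult_assoc_mat[of _ n n])
  then have "c \<cdot>\<^sub>m 1\<^sub>m n - A = P * (c \<cdot>\<^sub>m 1\<^sub>m n - B) * Q"
    using w by simp
  then show ?thesis
    using w by (intro similar_matI[of _ _ P Q n]) auto
qed

text \<open>Working with a triangular form rather than with eigenvectors keeps track of algebraic
  multiplicities: both spectra are read off as diagonals.\<close>

lemma eigenvalues_scalar_minus:
  assumes A: "A \<in> carrier_mat n n"
  shows "eigenvalues (c \<cdot>\<^sub>m 1\<^sub>m n - A) = image_mset (\<lambda>x. c - x) (eigenvalues A)"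
proof -
  obtain es where "char_poly A = (\<Prod>a\<leftarrow>es. [:- a, 1:])"
    using char_poly_factorized[OF A] by blast
  then obtain T where T: "T \<in> carrier_mat n n" "upper_triangular T" "similar_mat A T"
    using schur_decomposition_exists[OF A] by blast
  have "upper_triangular (c \<cdot>\<^sub>m 1\<^sub>m n - T)"
    using T(1,2) by (auto simp: upper_triangular_def)
  moreover have "diag_mat (c \<cdot>\<^sub>m 1\<^sub>m n - T) = map (\<lambda>x. c - x) (diag_mat T)"
    using T(1) by (simp add: diag_mat_def)
  moreover have "c \<cdot>\<^sub>m 1\<^sub>m n - T \<in> carrier_mat n n"
    using T(1) by auto
  ultimately have "eigenvalues (c \<cdot>\<^sub>m 1\<^sub>m n - T) = image_mset (\<lambda>x. c - x) (eigenvalues T)"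
    using T by (simp add: eigenvalues_upper_triangular)
  then show ?thesis
    using eigenvalues_similar[OF T(3)]
      eigenvalues_similar[OF similar_mat_scalar_minus[OF A T(3)]] by simp
qed

text \<open>When the row sums of \<open>M\<close> are constant, this is the map induced by
  \<open>M\<close> on the quotient by the span of the all-ones vector, in the basis of the classes
  of all standard vectors but the first. There the first one equals minus the sum of the others,
  hence the subtracted term.\<close>

definition deflation :: "'a :: ring_1 mat \<Rightarrow> nat \<Rightarrow> 'a mat" where
  "deflation M m = mat m m (\<lambda>(i, j). M $$ (Suc i, Suc j) - M $$ (0, Suc j))"

lemma deflation_carrier [simp]: "deflation M m \<in> carrier_mat m m"
  by (simp add: deflation_def)

lemma similar_deflation:
  fixes M :: "'a :: field mat"
  assumes M: "M \<in> carrier_mat (Suc m) (Suc m)"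
    and row_sum: "\<And>i. i < Suc m \<Longrightarrow> (\<Sum>j<Suc m. M $$ (i, j)) = s"
  shows "similar_mat M
    (four_block_mat (mat 1 1 (\<lambda>_. s)) (mat 1 m (\<lambda>(i, j). M $$ (0, Suc j)))
      (0\<^sub>m m 1) (deflation M m))"
    (is "similar_mat M ?T")
proof -
  \<comment> \<open>The columns of \<open>P\<close> are the all-ones vector and the standard vectors
    after the first. Left multiplication by \<open>Q\<close> undoes \<open>P\<close>: it subtracts
    row 0 from every other row.\<close>
  define P :: "'a mat" where
    "P = mat (Suc m) (Suc m) (\<lambda>(i, j). if j = 0 \<or> i = j then 1 else 0)"
  define Q :: "'a mat" where
    "Q = mat (Suc m) (Suc m) (\<lambda>(i, j). if i = j then 1 else if j = 0 then -1 else 0)"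
  have P: "P \<in> carrier_mat (Suc m) (Suc m)" and Q: "Q \<in> carrier_mat (Suc m) (Suc m)"
    by (simp_all add: P_def Q_def)
  have T: "?T \<in> carrier_mat (Suc m) (Suc m)"
    using four_block_carrier_mat[of "mat 1 1 (\<lambda>_. s)" 1 1 "deflation M m" m m] by simp
  \<comment> \<open>Row \<open>i\<close> of \<open>P\<close> has ones at positions 0 and
    \<open>i\<close>. For \<open>i = 0\<close> these coincide and must be counted once.\<close>
  have P_mult: "(P * X) $$ (i, j) = X $$ (0, j) + (if i = 0 then 0 else X $$ (i, j))"
    if X: "X \<in> carrier_mat (Suc m) (Suc m)" and ij: "i < Suc m" "j < Suc m" for X i j
  proof -
    have "(P * X) $$ (i, j) = (\<Sum>k\<in>{0..<Suc m}. P $$ (i, k) * X $$ (k, j))"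
      using P X ij by (simp add: scalar_prod_def del: sum.op_ivl_Suc)
    also have "\<dots> = (\<Sum>k\<in>{0..<Suc m}. (if k = 0 then X $$ (0, j) else 0)
        + (if k = i then if i = 0 then 0 else X $$ (i, j) else 0))"
      using ij by (intro sum.cong) (auto simp: P_def)
    also have "\<dots> = X $$ (0, j) + (if i = 0 then 0 else X $$ (i, j))"
      using ij by (simp add: sum.distrib del: sum.op_ivl_Suc)
    finally show ?thesis .
  qed
  have PQ: "P * Q = 1\<^sub>m (Suc m)"
  proof (rule eq_matI, goal_cases)
    case (1 i j)
    then show ?case
      by (simp add: P_mult[OF Q]) (auto simp: Q_def)
  qed (use P Q in auto)
  have QP: "Q * P = 1\<^sub>m (Suc m)"
    using mat_mult_left_right_inverse[OF P Q PQ] .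
  \<comment> \<open>Column 0 says that the all-ones vector is an eigenvector for \<open>s\<close>.
    In any later column, \<open>P\<close> adds row 0 of \<open>M\<close> back to the differences in
    \<open>deflation M m\<close> and so restores the entries of \<open>M\<close>.\<close>
  have MP: "M * P = P * ?T"
  proof (rule eq_matI, goal_cases)
    case (1 i j)
    then have ij: "i < Suc m" "j < Suc m"
      using P T by auto
    have MP: "(M * P) $$ (i, j) = (\<Sum>k<Suc m. M $$ (i, k) * P $$ (k, j))"
      using M P ij by (simp add: scalar_prod_def lessThan_atLeast0 del: sum.op_ivl_Suc)
    show ?case
    proof (cases "j = 0")
      case True
      then have "(M * P) $$ (i, j) = s"
        using MP row_sum[OF ij(1)] by (simp add: P_def del: sum.lessThan_Suc)
      then show ?thesis
        unfolding P_mult[OF T ij] using True ij by (simp add: four_block_mat_def deflation_def)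
    next
      case False
      have "(M * P) $$ (i, j) = (\<Sum>k<Suc m. if k = j then M $$ (i, j) else 0)"
        unfolding MP using ij False by (intro sum.cong) (auto simp: P_def)
      then have "(M * P) $$ (i, j) = M $$ (i, j)"
        using ij by (simp del: sum.lessThan_Suc)
      then show ?thesis
        unfolding P_mult[OF T ij] using False ij by (simp add: four_block_mat_def deflation_def)
    qed
  qed (use M P T in auto)
  have "M = M * (P * Q)"
    using M PQ by simp
  also have "\<dots> = P * ?T * Q"
    using M P Q MP by (simp flip: assoc_mult_mat[of M "Suc m" "Suc m" P "Suc m" Q "Suc m"])
  finally show ?thesis
    using M P Q T PQ QP by (intro similar_matI[of _ _ P Q "Suc m"]) auto
qed

text \<open>The characteristic polynomial of the block triangular form is a product, so exactly one
  copy of \<open>s\<close> is split off; further copies may remain in the deflation.\<close>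

lemma eigenvalues_constant_row_sum:
  assumes M: "M \<in> carrier_mat (Suc m) (Suc m)"
    and row_sum: "\<And>i. i < Suc m \<Longrightarrow> (\<Sum>j<Suc m. M $$ (i, j)) = s"
  shows "eigenvalues M = add_mset s (eigenvalues (deflation M m))"
proof -
  let ?S = "mat 1 1 (\<lambda>_. s)"
  have "upper_triangular ?S" "diag_mat ?S = [s]"
    by (auto simp: diag_mat_def)
  then have S: "char_poly ?S = [:- s, 1:]"
    using char_poly_upper_triangular[of ?S 1] by simp
  have "char_poly M = char_poly ?S * char_poly (deflation M m)"
    using char_poly_similar[OF similar_deflation[OF assms]]
      char_poly_four_block_zeros_col[of ?S "mat 1 m (\<lambda>(i, j). M $$ (0, Suc j))" m "deflation M m"]
    by simp
  \<comment> \<open>The roots of a product are the multiset sum of the roots of its factors only if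
    no factor is zero.\<close>
  moreover have "char_poly (deflation M m) \<noteq> 0"
    using degree_monic_char_poly[OF deflation_carrier, of M m] by auto
  ultimately show ?thesis
    by (simp add: eigenvalues_def S proots_mult del: mult_pCons_left One_nat_def)
qed

theorem lemma5p10:
  fixes D :: "'a pair_pre_digraph" and vs :: "'a list"
    and n r \<sigma> :: nat and ev :: "nat \<Rightarrow> complex"
  assumes "self_loop_digraph D"
    and "distinct vs" and "set vs = pverts D"
    and "n = card (pverts D)"
    and "\<sigma> = card (self_loops D)"
    and "regular_digraph r D"
    and "eigenvalues (adj_matrix vs D) =
           add_mset (of_nat r) (image_mset ev (mset_set {2..n}))"
  shows "eigenvalues (adj_matrix vs (complement_digraph D)) =
           add_mset (of_nat n - of_nat r - of_nat (loop_delta \<sigma>))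
             (image_mset (\<lambda>i. - of_nat (loop_delta \<sigma>) - ev i) (mset_set {2..n}))"
proof -
  define d :: complex where "d = of_nat (loop_delta \<sigma>)"
  define A where "A = adj_matrix vs D"
  define C where "C = adj_matrix vs (complement_digraph D)"
  have len: "length vs = n"
    using assms(2-4) distinct_card by metis
  have "n \<noteq> 0"
    using assms(1,3) len by (auto simp: self_loop_digraph_def self_loop_digraph_axioms_def)
  then obtain m where n: "n = Suc m"
    by (cases n) auto
  have A: "A \<in> carrier_mat (Suc m) (Suc m)"
    using len n by (simp add: A_def adj_matrix_def)
  have "C = all_ones_mat (Suc m) - d \<cdot>\<^sub>m 1\<^sub>m (Suc m) - A"
    using adj_matrix_complement[OF assms(1-3)] len n assms(5) by (simp add: A_def C_def d_def)
  then have C_entry: "C $$ (i, j) = 1 - d * (if i = j then 1 else 0) - A $$ (i, j)"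
      if "i < Suc m" "j < Suc m" for i j
    using A that by (auto simp: all_ones_mat_def)
  have C: "C \<in> carrier_mat (Suc m) (Suc m)"
    using len n by (simp add: C_def adj_matrix_def)
  have A_row: "(\<Sum>j<Suc m. A $$ (i, j)) = of_nat r" if i: "i < Suc m" for i
  proof -
    have v: "vs ! i \<in> pverts D"
      using i len n assms(3) nth_mem[of i vs] by simp
    have "bij_betw ((!) vs) {..<Suc m} (pverts D)"
      using bij_betw_nth[OF assms(2)] len n assms(3) by simp
    then have "(\<Sum>j<Suc m. A $$ (i, j)) = (\<Sum>v\<in>pverts D. adj_entry D (vs ! i) v)"
      using i len n by (subst sum.reindex_bij_betw[symmetric]) (auto simp: A_def adj_matrix_def)
    also have "\<dots> = of_nat r"
      using out_degree_eq_row_sum[OF assms(1) v] assms(6) v by (simp add: regular_digraph_def)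
    finally show ?thesis .
  qed
  have C_row: "(\<Sum>j<Suc m. C $$ (i, j)) = of_nat n - of_nat r - d" if i: "i < Suc m" for i
  proof -
    have "(\<Sum>j<Suc m. C $$ (i, j)) =
        (\<Sum>j<Suc m. 1 - d * (if i = j then 1 else 0) - A $$ (i, j))"
      using i C_entry by (intro sum.cong) auto
    also have "\<dots> = of_nat n - d - of_nat r"
      using i A_row[OF i] n
      by (simp add: sum_subtractf flip: sum_distrib_left del: sum.lessThan_Suc)
    finally show ?thesis
      by simp
  qed
  \<comment> \<open>The ones from \<open>J\<close> cancel in each difference. Position
    \<open>(0, Suc j)\<close> is off the diagonal, so the identity contributes only through
    \<open>(Suc i, Suc j)\<close>.\<close>
  have "deflation C m = (- d) \<cdot>\<^sub>m 1\<^sub>m m - deflation A m"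
    by (rule eq_matI) (auto simp: deflation_def C_entry)
  then have "eigenvalues C =
      add_mset (of_nat n - of_nat r - d) (image_mset (\<lambda>x. - d - x) (eigenvalues (deflation A m)))"
    using eigenvalues_constant_row_sum[OF C C_row] eigenvalues_scalar_minus[OF deflation_carrier]
    by simp
  \<comment> \<open>One copy of \<open>r\<close> is cancelled from two descriptions of the same
    multiset, which is sound even if some \<open>ev i\<close> equals \<open>r\<close>.\<close>
  moreover have "eigenvalues (deflation A m) = image_mset ev (mset_set {2..n})"
    using eigenvalues_constant_row_sum[OF A A_row] assms(7) by (simp add: A_def)
  ultimately show ?thesis
    by (simp add: C_def d_def image_mset.compositionality o_def)
qed

end
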